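(* As formal power series in $z$ and $q$, $$J(z;q) := \sum_{m,n\geq 0} j(m,n)\, z^m q^n = \frac{(-zq;q)_\infty}{(z^2q;q)_\infty}.$$
   Context: A 01-partition (jagged partition) of a non-negative integer $n$ is a finite sequence $(n_1,\dots,n_m)$ of non-negative integers with $\sum_i n_i = n$, whose last entry satisfies $n_m \geq 1$, and such that $n_j \geq n_{j+1}-1$ and $n_j \geq n_{j+2}$ whenever the indices are in range; $m$ is its length. The empty sequence is the unique 01-partition of $0$, of length $0$. $j(m,n)$ is the number of 01-partitions of $n$ of length exactly $m$. Notation: $(a;q)_\infty = \prod_{i\ge0}(1-aq^i)$. *)

theory Defs
  imports "HOL-Analysis.Analysis" "HOL-Computational_Algebra.Formal_Power_Series"
begin

unbundle no vec_syntax and fps_syntax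

text \<open>The condition \<open>n\<^sub>j \<ge> n\<^sub>j\<^sub>+\<^sub>1 - 1\<close> is written without
  subtraction, since subtraction on \<^typ>\<open>nat\<close> truncates.\<close>

definition jagged_partition :: "nat \<Rightarrow> nat list \<Rightarrow> bool" where
  "jagged_partition n xs \<longleftrightarrow>
     sum_list xs = n \<and>
     (xs \<noteq> [] \<longrightarrow> last xs \<ge> 1) \<and>
     (\<forall>j. j + 1 < length xs \<longrightarrow> xs ! j + 1 \<ge> xs ! (j + 1)) \<and>
     (\<forall>j. j + 2 < length xs \<longrightarrow> xs ! j \<ge> xs ! (j + 2))"

definition jagged_count :: "nat \<Rightarrow> nat \<Rightarrow> nat" where
  "jagged_count m n = card {xs. jagged_partition n xs \<and> length xs = m}"

lemma finite_jagged: "finite {xs. jagged_partition n xs \<and> length xs = m}"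
proof (rule finite_subset)
  show "{xs. jagged_partition n xs \<and> length xs = m} \<subseteq> {xs. set xs \<subseteq> {..n} \<and> length xs = m}"
    by (auto simp: jagged_partition_def intro: member_le_sum_list)
  show "finite {xs. set xs \<subseteq> {..n} \<and> length xs = m}"
    by (rule finite_lists_length_eq) simp
qed

lemma jagged_partition_0_iff: "jagged_partition 0 xs \<longleftrightarrow> xs = []"
proof
  assume xs: "jagged_partition 0 xs"
  hence "\<forall>x\<in>set xs. x = 0"
    by (simp add: jagged_partition_def)
  hence "xs \<noteq> [] \<Longrightarrow> last xs = 0"
    by simp
  with xs show "xs = []"
    by (cases "xs = []") (simp_all add: jagged_partition_def)
qed (simp add: jagged_partition_def)

text \<open>
  Series in \<open>z\<close> and \<open>q\<close> are series in \<open>q\<close> whose coefficients are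
  series in \<open>z\<close>: the coefficient of \<open>z\<^sup>m q\<^sup>n\<close> in \<open>F\<close> is
  \<open>F $ n $ m\<close>. The coefficients are rational because the library's division of formal power
  series needs an \<open>inverse\<close> operation on the coefficients, which \<^typ>\<open>int\<close> lacks.
\<close>

abbreviation zvar :: "rat fps fps" where
  "zvar \<equiv> fps_const fps_X"

abbreviation qvar :: "rat fps fps" where
  "qvar \<equiv> fps_X"

definition jagged_gf :: "rat fps fps" where
  "jagged_gf = Abs_fps (\<lambda>n. Abs_fps (\<lambda>m. of_nat (jagged_count m n)))"

definition qpochhammer_inf :: "'a :: {t2_space, comm_ring_1} \<Rightarrow> 'a \<Rightarrow> 'a" where
  "qpochhammer_inf a q = (\<Prod>i. 1 - a * q ^ i)"

text \<open>
  For power series the limit in this product is taken in the \<open>q\<close>-adic topology.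
  The following facts show that the products of interest converge, and that the
  result has constant coefficient 1 in \<open>q\<close>, so that one may divide by it.
\<close>

lemma has_prod_qpochhammer:
  fixes a :: "'a :: idom fps"
  assumes "a $ 0 = 0"
  shows "(\<lambda>i. 1 - a * fps_X ^ i) has_prod qpochhammer_inf a fps_X"
    and "qpochhammer_inf a fps_X $ 0 = 1"
proof -
  define P where "P = (\<lambda>n. \<Prod>i\<le>n. 1 - a * fps_X ^ i)"
  define L where "L = Abs_fps (\<lambda>k. P k $ k)"
  have step: "P (Suc n) $ k = P n $ k" if "k \<le> n" for n k
  proof -
    have "P (Suc n) = P n - (P n * a) * fps_X ^ Suc n"
      by (simp add: P_def algebra_simps)
    also have "\<dots> $ k = P n $ k"
      using that by (subst fps_sub_nth, subst fps_X_power_mult_right_nth) simp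
    finally show ?thesis .
  qed
  have stable: "P n $ k = L $ k" if "k \<le> n" for n k
    using that by (induction n rule: dec_induct) (auto simp: L_def step)
  have "P \<longlonglongrightarrow> L"
    by (rule tendsto_fpsI, rule eventually_sequentiallyI, rule stable)
  moreover have L0: "L $ 0 = 1"
    using assms by (simp add: L_def P_def)
  moreover have "L \<noteq> 0"
    using L0 by auto
  ultimately have *: "(\<lambda>i. 1 - a * fps_X ^ i) has_prod L"
    by (simp add: has_prod_def raw_has_prod_def P_def)
  hence "qpochhammer_inf a fps_X = L"
    unfolding qpochhammer_inf_def by (rule has_prod_unique [symmetric])
  thus "(\<lambda>i. 1 - a * fps_X ^ i) has_prod qpochhammer_inf a fps_X"
    and "qpochhammer_inf a fps_X $ 0 = 1"
    using * L0 by simp_all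
qed

end

theory Submission
  imports Defs
begin

text \<open>
  A 01-partition that contains a zero ends in \<open>0, 1\<close>, and deleting these two entries leaves a
  01-partition; one without zeros becomes, after subtracting 1 from every entry, a sequence
  satisfying the same inequalities whose last entry may be zero. Such a sequence is a 01-partition
  followed by zeros. If \<open>G\<close> counts these sequences, this means
  \<open>(1 - z\<^sup>2 q) J(z; q) = G(z q; q)\<close> and \<open>(1 - z) G(z; q) = J(z; q)\<close>, so
  \<open>(1 - z q) (1 - z\<^sup>2 q) J(z; q) = J(z q; q)\<close>. Iterating and letting
  \<open>J(z q\<^sup>k; q)\<close> tend to \<open>1\<close> gives a product for \<open>J\<close>, and the identity
  \<open>1 - z\<^sup>2 q\<^sup>2\<^sup>i = (1 - z q\<^sup>i) (1 + z q\<^sup>i)\<close> brings it to the stated form.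
\<close>

section \<open>Counting lists by length and sum\<close>

definition jagged_seq :: "nat list \<Rightarrow> bool" where
  "jagged_seq xs \<longleftrightarrow>
     (\<forall>j. j + 1 < length xs \<longrightarrow> xs ! j + 1 \<ge> xs ! (j + 1)) \<and>
     (\<forall>j. j + 2 < length xs \<longrightarrow> xs ! j \<ge> xs ! (j + 2))"

definition list_count :: "(nat list \<Rightarrow> bool) \<Rightarrow> nat \<Rightarrow> nat \<Rightarrow> nat" where
  "list_count P m n = card {xs. P xs \<and> length xs = m \<and> sum_list xs = n}"

abbreviation ends_positive :: "nat list \<Rightarrow> bool" where
  "ends_positive xs \<equiv> xs \<noteq> [] \<longrightarrow> last xs \<ge> 1"

lemma finite_lists_length_sum:
  "finite {xs :: nat list. P xs \<and> length xs = m \<and> sum_list xs = n}"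
proof (rule finite_subset)
  show "{xs. P xs \<and> length xs = m \<and> sum_list xs = n} \<subseteq> {xs. set xs \<subseteq> {..n} \<and> length xs = m}"
    by (auto intro: member_le_sum_list)
  show "finite {xs. set xs \<subseteq> {..n} \<and> length xs = m}"
    by (rule finite_lists_length_eq) simp
qed

lemma list_count_disj:
  assumes "\<And>xs. \<not> (P xs \<and> Q xs)"
  shows "list_count (\<lambda>xs. P xs \<or> Q xs) m n = list_count P m n + list_count Q m n"
proof -
  have "{xs. (P xs \<or> Q xs) \<and> length xs = m \<and> sum_list xs = n} =
    {xs. P xs \<and> length xs = m \<and> sum_list xs = n} \<union> {xs. Q xs \<and> length xs = m \<and> sum_list xs = n}"
    by auto
  thus ?thesis
    unfolding list_count_def using assms
    by (simp only:) (intro card_Un_disjoint finite_lists_length_sum; blast)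
qed

text \<open>Appending the fixed block \<open>zs\<close> is injective. The blocks used are
  \<open>[0, 1]\<close> and \<open>[0]\<close>; the guard keeps the truncated subtractions
  honest.\<close>

lemma list_count_append:
  "list_count (\<lambda>xs. \<exists>ys. xs = ys @ zs \<and> P ys) m n =
    (if length zs \<le> m \<and> sum_list zs \<le> n then list_count P (m - length zs) (n - sum_list zs) else 0)"
proof (cases "length zs \<le> m \<and> sum_list zs \<le> n")
  case True
  have "{xs. (\<exists>ys. xs = ys @ zs \<and> P ys) \<and> length xs = m \<and> sum_list xs = n} =
    (\<lambda>ys. ys @ zs) ` {ys. P ys \<and> length ys = m - length zs \<and> sum_list ys = n - sum_list zs}"
    using True by auto
  thus ?thesis
    using True by (simp add: list_count_def card_image inj_on_def)
next
  case False
  hence *: "{xs. (\<exists>ys. xs = ys @ zs \<and> P ys) \<and> length xs = m \<and> sum_list xs = n} = {}"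
    by auto
  show ?thesis
    using False unfolding list_count_def * by auto
qed

lemma sum_list_map_Suc: "sum_list (map Suc xs) = length xs + sum_list xs"
  by (induction xs) auto

lemma positive_iff_map_Suc: "0 \<notin> set xs \<longleftrightarrow> (\<exists>ys. xs = map Suc ys)"
proof
  assume "0 \<notin> set xs"
  hence "xs = map Suc (map (\<lambda>x. x - 1) xs)"
    by (auto intro!: map_idI [symmetric] Suc_pred gr0I simp: o_def)
  thus "\<exists>ys. xs = map Suc ys"
    by blast
qed auto

lemma jagged_seq_map_Suc [simp]: "jagged_seq (map Suc xs) \<longleftrightarrow> jagged_seq xs"
  by (auto simp: jagged_seq_def)

text \<open>Subtracting 1 from each of the \<open>m\<close> entries preserves the inequalities and
  lowers the sum by \<open>m\<close>.\<close>

lemma list_count_positive: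
  "list_count (\<lambda>xs. jagged_seq xs \<and> 0 \<notin> set xs) m n =
    (if m \<le> n then list_count jagged_seq m (n - m) else 0)"
proof (cases "m \<le> n")
  case True
  have "{xs. (jagged_seq xs \<and> 0 \<notin> set xs) \<and> length xs = m \<and> sum_list xs = n} =
    map Suc ` {ys. jagged_seq ys \<and> length ys = m \<and> sum_list ys = n - m}"
    using True by (auto simp: positive_iff_map_Suc sum_list_map_Suc)
  thus ?thesis
    using True by (simp add: list_count_def card_image inj_on_def)
next
  case False
  hence *: "{xs. (jagged_seq xs \<and> 0 \<notin> set xs) \<and> length xs = m \<and> sum_list xs = n} = {}"
    by (auto simp: positive_iff_map_Suc sum_list_map_Suc)
  show ?thesis
    using False unfolding list_count_def * by auto
qed

section \<open>Positions of zeros\<close>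

lemma jagged_seq_append_one:
  "jagged_seq (xs @ [a]) \<longleftrightarrow> jagged_seq xs \<and>
    (xs \<noteq> [] \<longrightarrow> a \<le> last xs + 1) \<and> (butlast xs \<noteq> [] \<longrightarrow> a \<le> last (butlast xs))"
proof (cases xs rule: rev_cases)
  case (snoc ys b)
  show ?thesis
  proof (cases ys rule: rev_cases)
    case Nil
    thus ?thesis
      using snoc by (auto simp: jagged_seq_def nth_append less_Suc_eq)
  next
    case (snoc zs c)
    show ?thesis
      unfolding \<open>xs = ys @ [b]\<close> \<open>ys = zs @ [c]\<close> jagged_seq_def
      by (auto simp: nth_append less_Suc_eq all_conj_distrib imp_conjL butlast_append)
  qed
qed (simp add: jagged_seq_def)

lemma jagged_seq_append_0 [simp]: "jagged_seq (xs @ [0]) \<longleftrightarrow> jagged_seq xs"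
  by (simp add: jagged_seq_append_one)

text \<open>The 1 is compared with the 0 before it, which allows it, and with the last entry of
  \<open>xs\<close>, which must therefore be positive.\<close>

lemma jagged_seq_append_01:
  "jagged_seq (xs @ [0, 1]) \<longleftrightarrow> jagged_seq xs \<and> ends_positive xs"
  using jagged_seq_append_one [of "xs @ [0]" 1] by auto

text \<open>A zero propagates in steps of two, by the second inequality, and so reaches one of the
  last two places.\<close>

lemma jagged_seq_zero_near_end:
  assumes "jagged_seq xs" "0 \<in> set xs"
  shows "last xs = 0 \<or> (\<exists>ys a. xs = ys @ [0, a])"
  using assms
proof (induction xs rule: rev_induct)
  case (snoc a xs)
  show ?case
  proof (cases "a = 0")
    case False
    with snoc.prems have "jagged_seq xs" "0 \<in> set xs" "xs \<noteq> []"
      by (auto simp: jagged_seq_append_one)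
    with snoc.IH consider "last xs = 0" | ys b where "xs = ys @ [0, b]"
      by metis
    thus ?thesis
    proof cases
      case 1
      with \<open>xs \<noteq> []\<close> show ?thesis
        by (metis append_butlast_last_id append_assoc append_Cons append_Nil)
    next
      \<comment> \<open>The new entry stands two places after a 0, which would force it to be
        0.\<close>
      case 2
      with snoc.prems False jagged_seq_append_one [of xs a] show ?thesis
        by (auto simp: butlast_append)
    qed
  qed simp
qed simp

lemma jagged_seq_ends_positive_iff:
  "jagged_seq xs \<and> ends_positive xs \<longleftrightarrow>
    jagged_seq xs \<and> 0 \<notin> set xs \<or> (\<exists>ys. xs = ys @ [0, 1] \<and> jagged_seq ys \<and> ends_positive ys)"
  (is "?L \<longleftrightarrow> ?R")
proof
  assume L: ?L
  show ?R
  proof (cases "0 \<notin> set xs")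
    case False
    hence "xs \<noteq> []"
      by auto
    with L False obtain ys a where xs: "xs = ys @ [0, a]"
      using jagged_seq_zero_near_end [of xs] by auto
    \<comment> \<open>An entry after 0 is at most 1, and the last entry is positive.\<close>
    with L jagged_seq_append_one [of "ys @ [0]" a] have "a = 1"
      by auto
    with xs L show ?thesis
      using jagged_seq_append_01 by auto
  qed (use L in auto)
next
  assume ?R
  moreover have "last xs \<ge> 1" if "0 \<notin> set xs" "xs \<noteq> []"
    using that last_in_set [of xs] by (cases "last xs = 0") auto
  ultimately show ?L
    by (auto simp: jagged_seq_append_01 jagged_seq_append_01 [of "[]", unfolded append_Nil]
        simp flip: One_nat_def)
qed

lemma jagged_seq_last_cases:
  "jagged_seq xs \<longleftrightarrow>
    jagged_seq xs \<and> ends_positive xs \<or> (\<exists>ys. xs = ys @ [0] \<and> jagged_seq ys)"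
proof (cases xs rule: rev_cases)
  case (snoc ys a)
  thus ?thesis
    by (cases "a = 0") (simp_all add: Suc_le_eq)
qed simp

section \<open>Generating functions and the functional equation\<close>

text \<open>If \<open>C(z; q)\<close> is the generating function of \<open>c\<close>, this is \<open>C(z q\<^sup>k; q)\<close>.\<close>

definition dilated_gf where
  "dilated_gf k c =
    Abs_fps (\<lambda>n. Abs_fps (\<lambda>m. if k * m \<le> n then of_nat (c m (n - k * m)) else 0 :: rat))"
  for c :: "nat \<Rightarrow> nat \<Rightarrow> nat"

lemma dilated_gf_add:
  "dilated_gf k (\<lambda>m n. c m n + d m n) = dilated_gf k c + dilated_gf k d"
  by (simp add: dilated_gf_def fps_eq_iff)

text \<open>Removing \<open>a\<close> entries of total \<open>b\<close> costs a factor
  \<open>z^a q^b\<close>, which becomes \<open>z^a q^(b + k a)\<close> when \<open>z\<close> is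
  replaced by \<open>z q^k\<close>.\<close>

lemma dilated_gf_shift:
  "dilated_gf k (\<lambda>m n. if a \<le> m \<and> b \<le> n then c (m - a) (n - b) else 0) =
    zvar ^ a * qvar ^ (b + k * a) * dilated_gf k c"
proof -
  have "(zvar ^ a * qvar ^ (b + k * a) * dilated_gf k c) $ n $ m =
    dilated_gf k (\<lambda>m n. if a \<le> m \<and> b \<le> n then c (m - a) (n - b) else 0) $ n $ m" for n m
  proof (cases "a \<le> m")
    case True
    then obtain d where "m = a + d"
      using le_Suc_ex by blast
    thus ?thesis
      by (auto simp: dilated_gf_def mult.assoc fps_const_power fps_mult_left_const_nth
          fps_X_power_mult_nth algebra_simps)
  next
    case False
    thus ?thesis
      by (auto simp: dilated_gf_def mult.assoc fps_const_power fps_mult_left_const_nth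
          fps_X_power_mult_nth)
  qed
  thus ?thesis
    by (simp add: fps_eq_iff)
qed

lemma jagged_count_eq_list_count:
  "jagged_count = list_count (\<lambda>xs. jagged_seq xs \<and> ends_positive xs)"
proof (intro ext)
  fix m n
  have "{xs. (jagged_seq xs \<and> ends_positive xs) \<and> length xs = m \<and> sum_list xs = n} =
    {xs. jagged_partition n xs \<and> length xs = m}"
    by (auto simp: jagged_partition_def jagged_seq_def)
  thus "jagged_count m n = list_count (\<lambda>xs. jagged_seq xs \<and> ends_positive xs) m n"
    by (simp add: list_count_def jagged_count_def)
qed

text \<open>The first summand counts the zero-free lists, the second those ending in
  \<open>[0, 1]\<close>.\<close>

lemma jagged_count_rec:
  "jagged_count m n = (if m \<le> n then list_count jagged_seq m (n - m) else 0) +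
    (if 2 \<le> m \<and> 1 \<le> n then jagged_count (m - 2) (n - 1) else 0)"
proof -
  have "jagged_count m n =
    list_count (\<lambda>xs. jagged_seq xs \<and> 0 \<notin> set xs \<or>
      (\<exists>ys. xs = ys @ [0, 1] \<and> jagged_seq ys \<and> ends_positive ys)) m n"
    unfolding jagged_count_eq_list_count
    by (rule fun_cong [OF fun_cong [OF arg_cong [where f = list_count]]])
      (rule ext, rule jagged_seq_ends_positive_iff)
  also have "\<dots> = list_count (\<lambda>xs. jagged_seq xs \<and> 0 \<notin> set xs) m n +
      list_count (\<lambda>xs. \<exists>ys. xs = ys @ [0, 1] \<and> jagged_seq ys \<and> ends_positive ys) m n"
    by (rule list_count_disj) auto
  finally show ?thesis
    by (simp add: list_count_positive list_count_append jagged_count_eq_list_count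
        numeral_2_eq_2)
qed

text \<open>The vacuous \<open>0 \<le> n\<close> and \<open>n - 0\<close> give the last summand the shape required by the shift rule
  for generating functions.\<close>

lemma list_count_jagged_seq_rec:
  "list_count jagged_seq m n = jagged_count m n +
    (if 1 \<le> m \<and> 0 \<le> n then list_count jagged_seq (m - 1) (n - 0) else 0)"
proof -
  have "list_count jagged_seq m n =
    list_count (\<lambda>xs. (jagged_seq xs \<and> ends_positive xs) \<or> (\<exists>ys. xs = ys @ [0] \<and> jagged_seq ys)) m n"
    by (rule fun_cong [OF fun_cong [OF arg_cong [where f = list_count]]])
      (rule ext, rule jagged_seq_last_cases)
  also have "\<dots> = list_count (\<lambda>xs. jagged_seq xs \<and> ends_positive xs) m n +
      list_count (\<lambda>xs. \<exists>ys. xs = ys @ [0] \<and> jagged_seq ys) m n"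
    by (rule list_count_disj) auto
  finally show ?thesis
    by (simp add: list_count_append jagged_count_eq_list_count)
qed

text \<open>Raising every entry by 1 replaces \<open>z\<close> by \<open>z q\<close>, hence
  \<open>z q^k\<close> by \<open>z q^(k + 1)\<close>.\<close>

lemma dilated_gf_positive:
  "dilated_gf k (\<lambda>m n. if m \<le> n then c m (n - m) else 0) = dilated_gf (Suc k) c"
  by (auto simp: dilated_gf_def fps_eq_iff algebra_simps)

lemma dilated_gf_step:
  "(1 - zvar * qvar ^ Suc k) * (1 - zvar ^ 2 * qvar ^ Suc (2 * k)) * dilated_gf k jagged_count =
    dilated_gf (Suc k) jagged_count"
proof -
  let ?J = "\<lambda>k. dilated_gf k jagged_count"
    and ?G = "dilated_gf (Suc k) (list_count jagged_seq)"
  have J: "jagged_count = (\<lambda>m n. (if m \<le> n then list_count jagged_seq m (n - m) else 0) +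
      (if 2 \<le> m \<and> 1 \<le> n then jagged_count (m - 2) (n - 1) else 0))"
    by (intro ext) (rule jagged_count_rec)
  have G: "list_count jagged_seq = (\<lambda>m n. jagged_count m n +
      (if 1 \<le> m \<and> 0 \<le> n then list_count jagged_seq (m - 1) (n - 0) else 0))"
    by (intro ext) (rule list_count_jagged_seq_rec)
  have "?J k = ?G + zvar ^ 2 * qvar ^ (1 + k * 2) * ?J k"
    using arg_cong [OF J, of "dilated_gf k"]
    unfolding dilated_gf_add dilated_gf_positive
      dilated_gf_shift [where a = 2 and b = 1 and c = jagged_count] .
  moreover have "?G = ?J (Suc k) + zvar ^ 1 * qvar ^ (0 + Suc k * 1) * ?G"
    using arg_cong [OF G, of "dilated_gf (Suc k)"]
    unfolding dilated_gf_add
      dilated_gf_shift [where a = 1 and b = 0 and c = "list_count jagged_seq"] .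
  \<comment> \<open>Both recurrences are linear; chaining them eliminates \<open>?G\<close>.\<close>
  ultimately have "(1 - zvar ^ 2 * qvar ^ Suc (2 * k)) * ?J k = ?G"
    "(1 - zvar * qvar ^ Suc k) * ?G = ?J (Suc k)"
    by (simp_all add: algebra_simps del: fps_const_power)
  thus ?thesis
    by (simp only: mult.assoc)
qed

lemma dilated_gf_product:
  "(\<Prod>i<k. (1 - zvar * qvar ^ Suc i) * (1 - zvar ^ 2 * qvar ^ Suc (2 * i))) * jagged_gf =
    dilated_gf k jagged_count"
proof (induction k)
  case 0
  show ?case
    by (simp add: jagged_gf_def dilated_gf_def)
next
  case (Suc k)
  show ?case
    using dilated_gf_step [of k] unfolding Suc.IH [symmetric]
    by (simp only: prod.lessThan_Suc mult_ac)
qed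

lemma prod_even_odd:
  fixes f :: "nat \<Rightarrow> 'a :: comm_monoid_mult"
  shows "(\<Prod>i<2 * k. f i) = (\<Prod>i<k. f (2 * i) * f (Suc (2 * i)))"
  by (induction k) (simp_all add: mult_ac)

text \<open>On the left, factors of even index are the \<open>1 - z^2 q^(2i+1)\<close> of the
  functional equation. Those of odd index, \<open>1 - z^2 q^(2i+2)\<close>, split as a difference of
  squares: one half is the remaining factor of that equation, the other goes into the
  numerator.\<close>

lemma jagged_gf_finite_product:
  "(\<Prod>i<2 * k. 1 - zvar ^ 2 * qvar * qvar ^ i) * jagged_gf =
    (\<Prod>i<k. 1 - - (zvar * qvar) * qvar ^ i) * dilated_gf k jagged_count"
proof -
  have "(\<Prod>i<2 * k. 1 - zvar ^ 2 * qvar * qvar ^ i) =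
    (\<Prod>i<k. (1 - - (zvar * qvar) * qvar ^ i) *
      ((1 - zvar * qvar ^ Suc i) * (1 - zvar ^ 2 * qvar ^ Suc (2 * i))))"
    unfolding prod_even_odd
  proof (rule prod.cong [OF refl])
    fix i
    have "1 - z ^ 2 * q * q ^ Suc (2 * i) = (1 - - (z * q) * q ^ i) * (1 - z * q ^ Suc i)"
      for z q :: "rat fps fps"
      by (simp add: algebra_simps power2_eq_square mult_2_right power_add)
    thus "(1 - zvar ^ 2 * qvar * qvar ^ (2 * i)) * (1 - zvar ^ 2 * qvar * qvar ^ Suc (2 * i)) =
      (1 - - (zvar * qvar) * qvar ^ i) *
      ((1 - zvar * qvar ^ Suc i) * (1 - zvar ^ 2 * qvar ^ Suc (2 * i)))"
      by (simp only: power_Suc mult_ac)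
  qed
  thus ?thesis
    by (simp only: prod.distrib mult.assoc dilated_gf_product [symmetric])
qed

section \<open>Passage to the limit\<close>

text \<open>Coefficient \<open>n\<close> of a product involves only the coefficients up to
  \<open>n\<close> of the factors, and finitely many eventual equalities hold
  simultaneously.\<close>

lemma tendsto_mult_fps:
  fixes f g :: "'b \<Rightarrow> 'a :: ring fps"
  assumes "(f \<longlongrightarrow> A) F" "(g \<longlongrightarrow> B) F"
  shows "((\<lambda>x. f x * g x) \<longlongrightarrow> A * B) F"
proof (rule tendsto_fpsI)
  fix n
  have "\<forall>\<^sub>F x in F. \<forall>i\<in>{..n}. f x $ i = A $ i"
    "\<forall>\<^sub>F x in F. \<forall>i\<in>{..n}. g x $ i = B $ i"
    using assms by (simp_all add: tendsto_fps_iff eventually_ball_finite)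
  thus "\<forall>\<^sub>F x in F. (f x * g x) $ n = (A * B) $ n"
    by eventually_elim (simp add: fps_mult_nth)
qed

lemma jagged_count_0_left: "jagged_count 0 n = (if n = 0 then 1 else 0)"
proof -
  have "{xs. jagged_partition n xs \<and> length xs = 0} = (if n = 0 then {[]} else {})"
    by (auto simp: jagged_partition_def)
  thus ?thesis
    by (simp add: jagged_count_def)
qed

lemma dilated_gf_tendsto_1: "(\<lambda>k. dilated_gf k jagged_count) \<longlonglongrightarrow> 1"
proof (rule tendsto_fpsI, rule eventually_sequentiallyI)
  fix n k :: nat
  assume "Suc n \<le> k"
  \<comment> \<open>Once \<open>k\<close> exceeds \<open>n\<close>, only the empty list can
    contribute to the coefficient of \<open>q^n\<close>.\<close>
  hence "k * m \<le> n \<longleftrightarrow> m = 0" for m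
    by (cases m) auto
  thus "dilated_gf k jagged_count $ n = 1 $ n"
    by (auto simp: dilated_gf_def fps_eq_iff jagged_count_0_left)
qed

theorem theorem16:
  shows "jagged_gf = qpochhammer_inf (- (zvar * qvar)) qvar / qpochhammer_inf (zvar ^ 2 * qvar) qvar"
proof -
  let ?B = "qpochhammer_inf (- (zvar * qvar)) qvar"
    and ?C = "qpochhammer_inf (zvar ^ 2 * qvar) qvar"
  have B: "(\<lambda>k. \<Prod>i<k. 1 - - (zvar * qvar) * qvar ^ i) \<longlonglongrightarrow> ?B"
    by (intro has_prod_imp_tendsto' has_prod_qpochhammer) simp
  have "(\<lambda>k. \<Prod>i<k. 1 - zvar ^ 2 * qvar * qvar ^ i) \<longlonglongrightarrow> ?C"
    by (intro has_prod_imp_tendsto' has_prod_qpochhammer) simp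
  \<comment> \<open>The finite identity involves only the partial products with an even number of
    factors.\<close>
  hence C: "(\<lambda>k. \<Prod>i<2 * k. 1 - zvar ^ 2 * qvar * qvar ^ i) \<longlonglongrightarrow> ?C"
    by (rule filterlim_compose) (simp add: filterlim_subseq strict_mono_def)
  have "(\<lambda>k. (\<Prod>i<2 * k. 1 - zvar ^ 2 * qvar * qvar ^ i) * jagged_gf) \<longlonglongrightarrow> ?C * jagged_gf"
    by (intro tendsto_mult_fps C tendsto_const)
  moreover have "(\<lambda>k. (\<Prod>i<2 * k. 1 - zvar ^ 2 * qvar * qvar ^ i) * jagged_gf) \<longlonglongrightarrow> ?B * 1"
    unfolding jagged_gf_finite_product by (intro tendsto_mult_fps B dilated_gf_tendsto_1)
  ultimately have eq: "?C * jagged_gf = ?B * 1"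
    by (rule LIMSEQ_unique)
  have C0: "?C $ 0 = 1"
    by (rule has_prod_qpochhammer) simp
  \<comment> \<open>The coefficient ring \<open>rat fps\<close> is not a field; \<open>?C\<close> is
    invertible because its constant coefficient in \<open>q\<close> is 1.\<close>
  hence inv: "?C * inverse ?C = 1"
    unfolding fps_inverse_def by (intro fps_right_inverse) (simp add: fps_inverse_one')
  have "jagged_gf = ?C * inverse ?C * jagged_gf"
    by (simp only: inv mult_1_left)
  also have "\<dots> = ?C * jagged_gf * inverse ?C"
    by (simp only: mult_ac)
  also have "\<dots> = ?B / ?C"
    by (simp only: eq mult_1_right fps_divide_unit C0 one_neq_zero not_False_eq_True)
  finally show ?thesis .
qed

end
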